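(* Let $k \geq 1$ be an integer. For any pair of vectors $\mathbf{v},\mathbf{w} \in \mathbb{R}^n$, we have \[ \| \mathbf{v}^{2k} \|\| \mathbf{w}^{2k} \| - \langle \mathbf{v}^{2k},\mathbf{w}^{2k}\rangle \leq \| \mathbf{v}^{k} \|^2\| \mathbf{w}^{k} \|^2 - \langle \mathbf{v}^{k},\mathbf{w}^{k}\rangle^2 \leq \|\mathbf{v}\|^{2k}\|\mathbf{w}\|^{2k} - \langle \mathbf{v},\mathbf{w}\rangle^{2k}. \]
   Context: For a vector $\mathbf{v}=(v_1,\ldots,v_n)\in\mathbb{R}^n$ and a positive integer $m$, $\mathbf{v}^m=(v_1^m,\ldots,v_n^m)$ is the entrywise $m$-th power. $\langle\cdot,\cdot\rangle$ and $\|\cdot\|$ are the usual dot product and Euclidean norm on $\mathbb{R}^n$. *)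

theory Defs
  imports "HOL-Analysis.Analysis"
begin

definition vec_power :: "real ^ 'n \<Rightarrow> nat \<Rightarrow> real ^ 'n"
  where "vec_power v m = (\<chi> i. (v $ i) ^ m)"

end

theory Submission
  imports Defs
begin

text \<open>
  For families \<open>x\<close>, \<open>y\<close> over a finite set, the defect in the Cauchy--Schwarz inequality is,
  by Lagrange's identity, half the sum of the squared minors
  \<open>(x\<^sub>i y\<^sub>j - x\<^sub>j y\<^sub>i)\<^sup>2\<close> over all ordered pairs. Both inequalities are comparisons of such sums.

  For the upper bound, read \<open>\<parallel>v\<parallel>\<^sup>2\<^sup>k \<parallel>w\<parallel>\<^sup>2\<^sup>k - \<langle>v,w\<rangle>\<^sup>2\<^sup>k\<close> as the defect of the \<open>k\<close>-fold tensor powers of \<open>v\<close>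
  and \<open>w\<close>, whose coordinates are indexed by the multi-indices of length \<open>k\<close>. For \<open>k \<ge> 1\<close> the
  constant multi-indices form a copy of the original index set, on which the tensor powers
  restrict to the entrywise powers \<open>v\<^sup>k\<close> and \<open>w\<^sup>k\<close>. Restricting to fewer coordinates only drops
  squared minors, so the defect decreases (\<open>gram_defect_mono\<close>, \<open>gram_defect_power_le\<close>).

  For the lower bound, put \<open>x = v\<^sup>k\<close>, \<open>y = w\<^sup>k\<close>, let \<open>D\<close> be the defect of \<open>x\<close>, \<open>y\<close> and
  \<open>S = \<Sum>\<^sub>i x\<^sub>i\<^sup>2 y\<^sub>i\<^sup>2\<close>. Then the claim is \<open>\<parallel>x\<^sup>2\<parallel> \<parallel>y\<^sup>2\<parallel> \<le> S + D\<close>, or after squaring, that the defect of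
  \<open>x\<^sup>2\<close>, \<open>y\<^sup>2\<close> is at most \<open>D (D + 2 S)\<close>. A minor of \<open>x\<^sup>2\<close>, \<open>y\<^sup>2\<close> factors as
  \<open>(x\<^sub>i y\<^sub>j - x\<^sub>j y\<^sub>i) (x\<^sub>i y\<^sub>j + x\<^sub>j y\<^sub>i)\<close>, so it is enough that the square of the second factor never
  exceeds \<open>D + 2 S\<close> when \<open>i \<noteq> j\<close> (\<open>permanent_square_le\<close>).
\<close>

definition gram_defect :: "'a set \<Rightarrow> ('a \<Rightarrow> real) \<Rightarrow> ('a \<Rightarrow> real) \<Rightarrow> real"
  where "gram_defect A x y = (\<Sum>i\<in>A. (x i)\<^sup>2) * (\<Sum>i\<in>A. (y i)\<^sup>2) - (\<Sum>i\<in>A. x i * y i)\<^sup>2"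

lemma lagrange_identity:
  "2 * gram_defect A x y = (\<Sum>i\<in>A. \<Sum>j\<in>A. (x i * y j - x j * y i)\<^sup>2)"
proof -
  have "(\<Sum>i\<in>A. \<Sum>j\<in>A. (x i * y j - x j * y i)\<^sup>2)
      = (\<Sum>i\<in>A. \<Sum>j\<in>A. (x i)\<^sup>2 * (y j)\<^sup>2) + (\<Sum>i\<in>A. \<Sum>j\<in>A. (x j)\<^sup>2 * (y i)\<^sup>2)
        - 2 * (\<Sum>i\<in>A. \<Sum>j\<in>A. (x i * y i) * (x j * y j))"
    by (simp add: power2_eq_square algebra_simps sum.distrib sum_subtractf sum_distrib_left)
  moreover have "(\<Sum>i\<in>A. \<Sum>j\<in>A. (x j)\<^sup>2 * (y i)\<^sup>2) = (\<Sum>i\<in>A. \<Sum>j\<in>A. (x i)\<^sup>2 * (y j)\<^sup>2)"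
    by (rule sum.swap)
  ultimately show ?thesis
    by (simp add: gram_defect_def sum_product power2_eq_square[of "sum _ _"])
qed

lemma gram_defect_mono:
  assumes "finite B" and "A \<subseteq> B"
  shows "gram_defect A x y \<le> gram_defect B x y"
proof -
  have "(\<Sum>i\<in>A. \<Sum>j\<in>A. (x i * y j - x j * y i)\<^sup>2) \<le> (\<Sum>i\<in>A. \<Sum>j\<in>B. (x i * y j - x j * y i)\<^sup>2)"
    using assms by (intro sum_mono sum_mono2) auto
  also have "\<dots> \<le> (\<Sum>i\<in>B. \<Sum>j\<in>B. (x i * y j - x j * y i)\<^sup>2)"
    using assms by (intro sum_mono2 sum_nonneg) auto
  finally show ?thesis
    by (simp flip: lagrange_identity)
qed

lemma gram_defect_nonneg: "finite A \<Longrightarrow> 0 \<le> gram_defect A x y"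
  using gram_defect_mono[of A "{}" x y] by (simp add: gram_defect_def)

lemma gram_defect_reindex:
  "inj_on h A \<Longrightarrow> gram_defect (h ` A) x y = gram_defect A (x \<circ> h) (y \<circ> h)"
  by (simp add: gram_defect_def sum.reindex)

text \<open>
  The coordinates of a \<open>k\<close>-fold tensor power are products over multi-indices
  \<open>f \<in> {..<k} \<rightarrow>\<^sub>E A\<close>, and inner products of tensor powers are powers of inner products.
\<close>

lemma sum_tensor_power:
  fixes z :: "'a \<Rightarrow> real"
  assumes "finite A"
  shows "(\<Sum>f\<in>{..<k} \<rightarrow>\<^sub>E A. \<Prod>t<k. z (f t)) = (\<Sum>i\<in>A. z i) ^ k"
  using prod_sum_PiE[of "{..<k}" "\<lambda>_. A" "\<lambda>_. z"] assms by simp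

lemma gram_defect_tensor_power:
  assumes "finite A"
  shows "gram_defect ({..<k} \<rightarrow>\<^sub>E A) (\<lambda>f. \<Prod>t<k. x (f t)) (\<lambda>f. \<Prod>t<k. y (f t))
       = (\<Sum>i\<in>A. (x i)\<^sup>2) ^ k * (\<Sum>i\<in>A. (y i)\<^sup>2) ^ k - (\<Sum>i\<in>A. x i * y i) ^ (2 * k)"
  using sum_tensor_power[OF assms, of "\<lambda>i. (x i)\<^sup>2" k]
    sum_tensor_power[OF assms, of "\<lambda>i. (y i)\<^sup>2" k]
    sum_tensor_power[OF assms, of "\<lambda>i. x i * y i" k]
  by (simp add: gram_defect_def prod_power_distrib prod.distrib power_mult mult.commute[of 2])

text \<open>
  The entrywise powers are the restrictions of the tensor powers to the constant multi-indices,
  which are pairwise distinct because \<open>k \<ge> 1\<close>.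
\<close>

lemma gram_defect_power_le:
  assumes "finite A" and "k \<ge> 1"
  shows "gram_defect A (\<lambda>i. x i ^ k) (\<lambda>i. y i ^ k)
       \<le> (\<Sum>i\<in>A. (x i)\<^sup>2) ^ k * (\<Sum>i\<in>A. (y i)\<^sup>2) ^ k - (\<Sum>i\<in>A. x i * y i) ^ (2 * k)"
proof -
  define diag where "diag = (\<lambda>i::'a. \<lambda>t\<in>{..<k}. i)"
  have "inj_on diag A"
  proof (rule inj_onI)
    fix i j assume "diag i = diag j"
    then have "diag i 0 = diag j 0" by simp
    then show "i = j" using \<open>k \<ge> 1\<close> by (simp add: diag_def)
  qed
  have "gram_defect A (\<lambda>i. x i ^ k) (\<lambda>i. y i ^ k)
      = gram_defect (diag ` A) (\<lambda>f. \<Prod>t<k. x (f t)) (\<lambda>f. \<Prod>t<k. y (f t))"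
    by (simp add: gram_defect_reindex[OF \<open>inj_on diag A\<close>] o_def) (simp add: diag_def)
  also have "\<dots> \<le> gram_defect ({..<k} \<rightarrow>\<^sub>E A) (\<lambda>f. \<Prod>t<k. x (f t)) (\<lambda>f. \<Prod>t<k. y (f t))"
    using \<open>finite A\<close> by (intro gram_defect_mono finite_PiE) (auto simp: diag_def split: if_splits)
  finally show ?thesis
    by (simp add: gram_defect_tensor_power[OF \<open>finite A\<close>])
qed

text \<open>
  Writing \<open>(x\<^sub>i y\<^sub>j + x\<^sub>j y\<^sub>i)\<^sup>2 = (x\<^sub>i y\<^sub>j - x\<^sub>j y\<^sub>i)\<^sup>2 + 4 (x\<^sub>i y\<^sub>i) (x\<^sub>j y\<^sub>j)\<close>, the first summand is the defect
  of the two-element set \<open>{i, j}\<close>, and the second is at most \<open>2 (x\<^sub>i y\<^sub>i)\<^sup>2 + 2 (x\<^sub>j y\<^sub>j)\<^sup>2\<close>, a partial sum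
  of \<open>2 S\<close>.
\<close>

lemma permanent_square_le:
  assumes "finite A" and "i \<in> A" and "j \<in> A" and "i \<noteq> j"
  shows "(x i * y j + x j * y i)\<^sup>2 \<le> gram_defect A x y + 2 * (\<Sum>l\<in>A. (x l)\<^sup>2 * (y l)\<^sup>2)"
proof -
  have "(x i * y j - x j * y i)\<^sup>2 = gram_defect {i, j} x y"
    using \<open>i \<noteq> j\<close> by (simp add: gram_defect_def power2_eq_square algebra_simps)
  also have "\<dots> \<le> gram_defect A x y"
    using assms by (intro gram_defect_mono) auto
  finally have minor: "(x i * y j - x j * y i)\<^sup>2 \<le> gram_defect A x y" .
  have "2 * (x i * y i) * (x j * y j) \<le> (x i * y i)\<^sup>2 + (x j * y j)\<^sup>2"
    by (rule sum_squares_bound)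
  also have "\<dots> = (\<Sum>l\<in>{i, j}. (x l)\<^sup>2 * (y l)\<^sup>2)"
    using \<open>i \<noteq> j\<close> by (simp add: power_mult_distrib)
  also have "\<dots> \<le> (\<Sum>l\<in>A. (x l)\<^sup>2 * (y l)\<^sup>2)"
    using assms by (intro sum_mono2) auto
  finally have "4 * (x i * y i) * (x j * y j) \<le> 2 * (\<Sum>l\<in>A. (x l)\<^sup>2 * (y l)\<^sup>2)"
    by linarith
  moreover have "(x i * y j + x j * y i)\<^sup>2
      = (x i * y j - x j * y i)\<^sup>2 + 4 * (x i * y i) * (x j * y j)"
    by (simp add: power2_eq_square algebra_simps)
  ultimately show ?thesis
    using minor by linarith
qed

lemma gram_defect_squares_le:
  assumes "finite A"
  shows "gram_defect A (\<lambda>i. (x i)\<^sup>2) (\<lambda>i. (y i)\<^sup>2)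
       \<le> gram_defect A x y * (gram_defect A x y + 2 * (\<Sum>i\<in>A. (x i)\<^sup>2 * (y i)\<^sup>2))"
    (is "_ \<le> ?D * ?M")
proof -
  have "((x i)\<^sup>2 * (y j)\<^sup>2 - (x j)\<^sup>2 * (y i)\<^sup>2)\<^sup>2 \<le> (x i * y j - x j * y i)\<^sup>2 * ?M"
    if "i \<in> A" "j \<in> A" for i j
  proof (cases "i = j")
    case False
    have "((x i)\<^sup>2 * (y j)\<^sup>2 - (x j)\<^sup>2 * (y i)\<^sup>2)\<^sup>2
        = (x i * y j - x j * y i)\<^sup>2 * (x i * y j + x j * y i)\<^sup>2"
      by (simp add: power2_eq_square algebra_simps)
    also have "\<dots> \<le> (x i * y j - x j * y i)\<^sup>2 * ?M"
      using permanent_square_le[OF assms that False] by (intro mult_left_mono) auto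
    finally show ?thesis .
  qed simp
  then have "(\<Sum>i\<in>A. \<Sum>j\<in>A. ((x i)\<^sup>2 * (y j)\<^sup>2 - (x j)\<^sup>2 * (y i)\<^sup>2)\<^sup>2)
      \<le> (\<Sum>i\<in>A. \<Sum>j\<in>A. (x i * y j - x j * y i)\<^sup>2 * ?M)"
    by (intro sum_mono)
  also have "\<dots> = 2 * ?D * ?M"
    by (simp only: lagrange_identity sum_distrib_right)
  finally show ?thesis
    by (simp flip: lagrange_identity)
qed

lemma sqrt_sum_fourth_powers_le:
  assumes "finite A"
  shows "sqrt (\<Sum>i\<in>A. (x i) ^ 4) * sqrt (\<Sum>i\<in>A. (y i) ^ 4) - (\<Sum>i\<in>A. (x i)\<^sup>2 * (y i)\<^sup>2)
       \<le> gram_defect A x y"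
proof -
  let ?S = "\<Sum>i\<in>A. (x i)\<^sup>2 * (y i)\<^sup>2"
  have "(\<Sum>i\<in>A. (x i) ^ 4) * (\<Sum>i\<in>A. (y i) ^ 4) = gram_defect A (\<lambda>i. (x i)\<^sup>2) (\<lambda>i. (y i)\<^sup>2) + ?S\<^sup>2"
    by (simp add: gram_defect_def)
  also have "\<dots> \<le> (gram_defect A x y + ?S)\<^sup>2"
    using gram_defect_squares_le[OF assms, of x y] by (simp add: power2_eq_square algebra_simps)
  finally have "sqrt ((\<Sum>i\<in>A. (x i) ^ 4) * (\<Sum>i\<in>A. (y i) ^ 4)) \<le> gram_defect A x y + ?S"
    using gram_defect_nonneg[OF assms, of x y] 
    by (intro real_le_lsqrt add_nonneg_nonneg sum_nonneg) auto
  then show ?thesis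
    by (simp add: real_sqrt_mult)
qed

lemma norm_square_eq_sum: "(norm (v :: real ^ 'n))\<^sup>2 = (\<Sum>i\<in>UNIV. (v $ i)\<^sup>2)"
  by (simp add: norm_vec_def L2_set_def sum_nonneg)

lemma gram_defect_vec_power:
  "gram_defect UNIV (\<lambda>i. v $ i ^ k) (\<lambda>i. w $ i ^ k)
     = (norm (vec_power v k))\<^sup>2 * (norm (vec_power w k))\<^sup>2 - (vec_power v k \<bullet> vec_power w k)\<^sup>2"
  by (simp add: gram_defect_def norm_square_eq_sum vec_power_def inner_vec_def)

theorem corollary3p6:
  fixes k :: nat and v w :: "real ^ 'n"
  assumes "k \<ge> 1"
  shows "norm (vec_power v (2 * k)) * norm (vec_power w (2 * k))
             - vec_power v (2 * k) \<bullet> vec_power w (2 * k)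
           \<le> (norm (vec_power v k))\<^sup>2 * (norm (vec_power w k))\<^sup>2
             - (vec_power v k \<bullet> vec_power w k)\<^sup>2
       \<and> (norm (vec_power v k))\<^sup>2 * (norm (vec_power w k))\<^sup>2
             - (vec_power v k \<bullet> vec_power w k)\<^sup>2
           \<le> norm v ^ (2 * k) * norm w ^ (2 * k) - (v \<bullet> w) ^ (2 * k)"
proof
  have norm_double: "norm (vec_power u (2 * k)) = sqrt (\<Sum>i\<in>UNIV. (u $ i ^ k) ^ 4)" for u :: "real ^ 'n"
    by (simp add: norm_vec_def L2_set_def vec_power_def flip: power_mult) (simp add: mult.commute)
  have inner_double: "vec_power v (2 * k) \<bullet> vec_power w (2 * k)
      = (\<Sum>i\<in>UNIV. (v $ i ^ k)\<^sup>2 * (w $ i ^ k)\<^sup>2)"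
    by (simp add: inner_vec_def vec_power_def mult.commute[of 2] power_mult)
  show "norm (vec_power v (2 * k)) * norm (vec_power w (2 * k))
          - vec_power v (2 * k) \<bullet> vec_power w (2 * k)
        \<le> (norm (vec_power v k))\<^sup>2 * (norm (vec_power w k))\<^sup>2
          - (vec_power v k \<bullet> vec_power w k)\<^sup>2"
    using sqrt_sum_fourth_powers_le[of UNIV "\<lambda>i. v $ i ^ k" "\<lambda>i. w $ i ^ k"]
    by (simp only: norm_double inner_double gram_defect_vec_power finite)
  show "(norm (vec_power v k))\<^sup>2 * (norm (vec_power w k))\<^sup>2
          - (vec_power v k \<bullet> vec_power w k)\<^sup>2
        \<le> norm v ^ (2 * k) * norm w ^ (2 * k) - (v \<bullet> w) ^ (2 * k)"
    using gram_defect_power_le[OF finite assms, of UNIV "($) v" "($) w"]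
    by (simp add: gram_defect_vec_power inner_vec_def power_mult flip: norm_square_eq_sum)
qed

end
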